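(* Let $q$ be a power of a prime, $V=\mathbb{F}_q^2$, and let $G$ be a group with $SL_2(V)<G\leq GL_2(V)$. Let $d=|\det(G)|$. If $\mathcal{F}\subseteq G$ is an intersecting set of $G$, then $|\mathcal{F}|\leq dq$. In particular, $|\mathcal{F}|=dq$ if and only if $\mathcal{F}$ is either a coset of $G_v$ for some $v\in V\setminus\{0\}$ or a coset of $\mathcal{G}_{\langle w\rangle}$ for some $w\in V\setminus\{0\}$.
   Context: $V=\mathbb{F}_q^2$ is the $2$-dimensional column vector space over the finite field $\mathbb{F}_q$, and $G$ acts naturally on it; $SL_2(V)<G$ means that $SL_2(V)$ is a proper subgroup of $G$. $\det(G)\subseteq\mathbb{F}_q^*$ is the set of determinants of all elements of $G$. A subset $A\subseteq G$ is intersecting if for all $\delta,\tau\in A$ there exists $u\in V\setminus\{0\}$ with $\delta(u)=\tau(u)$. For $v\in V$, $G_v=\{g\in G: g(v)=v\}$ is the stabilizer of the vector $v$. For $w\in V\setminus\{0\}$, $\langle w\rangle$ is the $1$-dimensional subspace spanned by $w$, and $\mathcal{G}_{\langle w\rangle}=\{M\in G:\ \forall u\in V,\ Mu-u\in\langle w\rangle\}$, which is a subgroup of $G$. *)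

theory Defs
  imports "HOL-Analysis.Analysis" "HOL-Algebra.Left_Coset"
begin

definition GL2 :: "('a::field ^ 2 ^ 2) monoid" where
  "GL2 = \<lparr>carrier = {A. invertible A}, mult = (**), one = mat 1\<rparr>"

definition SL2 :: "('a::field ^ 2 ^ 2) set" where
  "SL2 = {A. det A = 1}"

definition intersecting :: "('a::field ^ 2 ^ 2) set \<Rightarrow> bool" where
  "intersecting F \<longleftrightarrow> (\<forall>A\<in>F. \<forall>B\<in>F. \<exists>u. u \<noteq> 0 \<and> A *v u = B *v u)"

definition vec_stabilizer :: "('a::field ^ 2 ^ 2) set \<Rightarrow> 'a ^ 2 \<Rightarrow> ('a ^ 2 ^ 2) set" where
  "vec_stabilizer G v = {M \<in> G. M *v v = v}"

definition line_group :: "('a::field ^ 2 ^ 2) set \<Rightarrow> 'a ^ 2 \<Rightarrow> ('a ^ 2 ^ 2) set" where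
  "line_group G w = {M \<in> G. \<forall>u. M *v u - u \<in> vec.span {w}}"

(* A coset may be taken on either side. *)
definition is_coset :: "('g, 'b) monoid_scheme \<Rightarrow> 'g set \<Rightarrow> 'g set \<Rightarrow> bool" where
  "is_coset G H X \<longleftrightarrow> X \<in> lcosets\<^bsub>G\<^esub> H \<or> X \<in> rcosets\<^bsub>G\<^esub> H"

lemma group_GL2: "group (GL2 :: ('a::field ^ 2 ^ 2) monoid)"
proof (rule groupI)
  fix A :: "'a ^ 2 ^ 2"
  assume "A \<in> carrier GL2"
  then obtain B where B: "A ** B = mat 1" "B ** A = mat 1"
    by (auto simp: GL2_def invertible_def)
  then have "B \<in> carrier GL2"
    by (auto simp: GL2_def invertible_def)
  with B show "\<exists>B\<in>carrier GL2. B \<otimes>\<^bsub>GL2\<^esub> A = \<one>\<^bsub>GL2\<^esub>"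
    by (auto simp: GL2_def)
qed (auto simp: GL2_def matrix_mul_assoc invertible_mult invertible_det_nz det_mul)

lemma subgroup_line_group:
  fixes w :: "'a::field ^ 2"
  assumes G: "subgroup G GL2"
  shows "subgroup (line_group G w) (GL2\<lparr>carrier := G\<rparr>)"
proof -
  interpret GL: group "GL2 :: ('a ^ 2 ^ 2) monoid" by (rule group_GL2)
  have one: "(\<one>\<^bsub>GL2\<^esub> :: 'a ^ 2 ^ 2) = mat 1"
    and mult: "\<And>A B :: 'a ^ 2 ^ 2. A \<otimes>\<^bsub>GL2\<^esub> B = A ** B"
    by (simp_all add: GL2_def)
  have "subgroup (line_group G w) GL2"
  proof (rule GL.subgroupI)
    show "line_group G w \<subseteq> carrier GL2"
      using subgroup.subset[OF G] by (auto simp: line_group_def)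
    have "mat 1 \<in> line_group G w"
      using subgroup.one_closed[OF G] by (simp add: line_group_def one vec.span_zero)
    then show "line_group G w \<noteq> {}" by blast
  next
    fix A assume A: "A \<in> line_group G w"
    then have AG: "A \<in> G" by (simp add: line_group_def)
    let ?B = "inv\<^bsub>GL2\<^esub> A"
    have B: "?B \<in> G" using subgroup.m_inv_closed[OF G AG] .
    have AB: "A ** ?B = mat 1"
      using GL.r_inv[of A] AG subgroup.subset[OF G] by (auto simp: one mult)
    have "?B *v u - u \<in> vec.span {w}" for u
    proof -
      have "A *v (?B *v u) - ?B *v u \<in> vec.span {w}"
        using A by (simp add: line_group_def)
      then have "u - ?B *v u \<in> vec.span {w}"
        by (simp add: matrix_vector_mul_assoc AB)
      then show ?thesis
        using vec.span_neg by force
    qed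
    with B show "?B \<in> line_group G w" by (simp add: line_group_def)
  next
    fix A B assume A: "A \<in> line_group G w" and B: "B \<in> line_group G w"
    have "A ** B \<in> G"
      using subgroup.m_closed[OF G, of A B] A B by (simp add: line_group_def mult)
    moreover have "(A ** B) *v u - u \<in> vec.span {w}" for u
    proof -
      have "(A *v (B *v u) - B *v u) + (B *v u - u) \<in> vec.span {w}"
        using A B by (intro vec.span_add) (auto simp: line_group_def)
      then show ?thesis by (simp add: matrix_vector_mul_assoc)
    qed
    ultimately show "A \<otimes>\<^bsub>GL2\<^esub> B \<in> line_group G w"
      by (simp add: line_group_def mult)
  qed
  then show ?thesis
    by (rule GL.subgroup_incl[OF _ G]) (auto simp: line_group_def)
qed

end

theory Submission
  imports Defs
begin

text \<open>
  Two matrices agree on a nonzero vector exactly when the determinant of their difference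
  vanishes, so an intersecting set is a set of \<open>2 \<times> 2\<close> matrices whose pairwise differences
  have rank at most one.  Such sets are easily classified.  Translate one member to \<open>0\<close>; all
  members become rank-one matrices \<open>a x\<^sup>T\<close>, and since
  \<open>det (a x\<^sup>T - b y\<^sup>T) = - det[a, b] det[x, y]\<close>, any two of them share their column direction or
  their row direction.  In fact one direction is common to all of them
  (\<open>pairwise_singular_cases\<close>).

  Let \<open>A\<close> be a member of the intersecting set.  If the differences \<open>M - A\<close> have a common row
  direction, they annihilate a common vector \<open>v\<close>, and \<open>M\<close> lies in the coset of the stabilizer of
  \<open>v\<close> that contains \<open>A\<close>.  If they have a common column direction \<open>w\<close>, then \<open>M A\<^sup>-\<^sup>1 - 1\<close> has image in
  the line of \<open>w\<close>, and \<open>M\<close> lies in a coset of the line group of \<open>w\<close>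
  (\<open>intersecting_subset_coset\<close>).

  It remains to see that both subgroups have order \<open>d q\<close>, for then an intersecting set has at
  most \<open>d q\<close> elements, with equality exactly if it fills the coset.  The group contains \<open>SL\<^sub>2\<close>,
  hence consists of all matrices whose determinant lies in \<open>det G\<close>.  The stabilizer and the line
  group are made of the matrices \<open>1 + a y\<^sup>T\<close> with \<open>y\<close> or \<open>a\<close> held fixed, respectively, and
  \<open>det (1 + a y\<^sup>T) = 1 + a \<sqdot> y\<close> is a nonconstant affine function of the other vector.  Each of the
  \<open>d\<close> admissible determinants is therefore attained \<open>q\<close> times (\<open>card_affine_preimage\<close>).
\<close>

section \<open>Rank-one matrices\<close>

definition outer :: "'a::field ^ 2 \<Rightarrow> 'a ^ 2 \<Rightarrow> 'a ^ 2 ^ 2" where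
  "outer a x = (\<chi> i j. a $ i * x $ j)"

definition dot2 :: "'a::field ^ 2 \<Rightarrow> 'a ^ 2 \<Rightarrow> 'a" where
  "dot2 x y = x $ 1 * y $ 1 + x $ 2 * y $ 2"

definition cross2 :: "'a::field ^ 2 \<Rightarrow> 'a ^ 2 \<Rightarrow> 'a" where
  "cross2 a b = a $ 1 * b $ 2 - a $ 2 * b $ 1"

lemma outer_mult_vec: "outer a x *v u = dot2 x u *s a"
  by (simp add: outer_def dot2_def matrix_vector_mult_def vec_eq_iff forall_2 sum_2 algebra_simps)

lemma outer_mult_matrix: "outer a x ** M = outer a (x v* M)"
  by (simp add: outer_def matrix_matrix_mult_def vector_matrix_mult_def vec_eq_iff
      forall_2 sum_2 algebra_simps)

lemma matrix_add_rdistrib: "(A + B) ** C = A ** C + B ** (C :: 'a::semiring_1 ^ 'n ^ 'm)"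
  by (vector matrix_matrix_mult_def sum.distrib[symmetric] distrib_right)

lemma outer_scale_left: "outer (c *s a) x = outer a (c *s x)"
  by (simp add: outer_def vec_eq_iff mult_ac)

lemma outer_zero [simp]: "outer 0 x = 0" "outer a 0 = 0"
  by (simp_all add: outer_def vec_eq_iff)

text \<open>
  The difference is the product of the matrix with columns \<open>a, b\<close> and the one with rows
  \<open>x, -y\<close>, which is why its determinant factors.
\<close>

lemma det_outer_diff: "det (outer a x - outer b y) = - (cross2 a b * cross2 x y)"
  by (simp add: det_2 outer_def cross2_def algebra_simps)

lemma det_one_plus_outer: "det (mat 1 + outer a x) = 1 + dot2 a x"
  by (simp add: det_2 outer_def dot2_def mat_def algebra_simps)

lemma cross2_eq_0D:
  assumes "cross2 a b = 0" "a \<noteq> 0"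
  shows "\<exists>c. b = c *s a"
proof (cases "a $ 1 = 0")
  case True
  with assms have "a $ 2 \<noteq> 0" by (auto simp: vec_eq_iff forall_2)
  with True assms have "b = (b $ 2 / a $ 2) *s a"
    by (auto simp: cross2_def vec_eq_iff forall_2)
  then show ?thesis ..
next
  case False
  with assms have "b = (b $ 1 / a $ 1) *s a"
    by (auto simp: cross2_def vec_eq_iff forall_2 field_simps)
  then show ?thesis ..
qed

text \<open>In dimension two, the orthogonal complement of \<open>x\<close> is spanned by \<open>x\<close> turned by a right angle.\<close>

lemma dot2_eq_0D:
  assumes "dot2 x u = 0" "x \<noteq> 0"
  shows "\<exists>c. u = c *s vector [- x $ 2, x $ 1]"
proof -
  have "cross2 (vector [- x $ 2, x $ 1]) u = - dot2 x u"
    by (simp add: cross2_def dot2_def algebra_simps)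
  then have "cross2 (vector [- x $ 2, x $ 1]) u = 0"
    using assms(1) by simp
  moreover have "vector [- x $ 2, x $ 1] \<noteq> (0 :: 'a ^ 2)"
    using assms(2) by (auto simp: vec_eq_iff forall_2)
  ultimately show ?thesis by (rule cross2_eq_0D)
qed

lemma det_eq_0_imp_outer:
  fixes M :: "'a::field ^ 2 ^ 2"
  assumes "det M = 0"
  shows "\<exists>a x. M = outer a x"
proof (cases "M $ 1 = 0")
  case True
  then have "M = outer (vector [0, 1]) (M $ 2)"
    by (simp add: outer_def vec_eq_iff forall_2)
  then show ?thesis by blast
next
  case False
  have "cross2 (M $ 1) (M $ 2) = 0"
    using assms by (simp add: det_2 cross2_def)
  with False obtain c where "M $ 2 = c *s M $ 1"
    using cross2_eq_0D by blast
  then have "M = outer (vector [1, c]) (M $ 1)"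
    by (simp add: outer_def vec_eq_iff forall_2)
  then show ?thesis by blast
qed

lemma det_eq_0_iff_kernel:
  fixes M :: "'a::field ^ 2 ^ 2"
  shows "det M = 0 \<longleftrightarrow> (\<exists>u. u \<noteq> 0 \<and> M *v u = 0)"
  using invertible_det_nz[of M] matrix_left_invertible_ker[of M] invertible_left_inverse[of M]
  by blast

section \<open>Sets of matrices with singular differences\<close>

text \<open>
  Suppose that two members \<open>a x\<^sup>T\<close> and \<open>b y\<^sup>T\<close> have different column directions.  Then \<open>x\<close> and \<open>y\<close>
  are parallel.  A further member \<open>c z\<^sup>T\<close> with a different row direction would have \<open>c\<close> parallel
  both to \<open>a\<close> and to \<open>b\<close>, which forces \<open>c = 0\<close>.  So all members share the row direction \<open>x\<close>.
\<close>

lemma pairwise_singular_cases: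
  fixes S :: "('a::field ^ 2 ^ 2) set"
  assumes zero: "0 \<in> S"
    and sing: "\<And>M N. M \<in> S \<Longrightarrow> N \<in> S \<Longrightarrow> det (M - N) = 0"
  shows "(\<exists>w. w \<noteq> 0 \<and> (\<forall>M\<in>S. \<exists>x. M = outer w x)) \<or>
         (\<exists>x. x \<noteq> 0 \<and> (\<forall>M\<in>S. \<exists>a. M = outer a x))"
proof (cases "S \<subseteq> {0}")
  case True
  have "(1 :: 'a ^ 2) \<noteq> 0" by simp
  moreover have "\<forall>M\<in>S. \<exists>x. M = outer (1 :: 'a ^ 2) x"
    using True outer_zero(2) by (metis singletonD subsetD)
  ultimately show ?thesis by blast
next
  case False
  have factor: "\<exists>a x. M = outer a x" if "M \<in> S" for M
    using det_eq_0_imp_outer[of M] sing[OF that zero] by simp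
  have cross: "cross2 a b = 0 \<or> cross2 x y = 0" if "outer a x \<in> S" "outer b y \<in> S" for a b x y
    using sing[OF that] by (simp add: det_outer_diff)
  from False obtain a x where M: "outer a x \<in> S" "outer a x \<noteq> 0"
    using factor by blast
  then have nz: "a \<noteq> 0" "x \<noteq> 0" by auto
  show ?thesis
  proof (cases "\<forall>N\<in>S. \<exists>y. N = outer a y")
    case True
    with nz show ?thesis by blast
  next
    case False
    then obtain b y where N: "outer b y \<in> S" and not_a: "\<And>z. outer b y \<noteq> outer a z"
      using factor by metis
    have ab: "cross2 a b \<noteq> 0"
      using cross2_eq_0D[of a b] nz(1) not_a by (metis outer_scale_left)
    then obtain s where y: "y = s *s x"
      using cross[OF M(1) N] cross2_eq_0D[of x y] nz by blast
    have s: "s \<noteq> 0"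
      using not_a[of 0] y by auto
    have "\<exists>d. P = outer d x" if P: "P \<in> S" for P
    proof -
      obtain c z where cz: "P = outer c z" using factor[OF P] by blast
      show ?thesis
      proof (cases "cross2 x z = 0")
        case True
        then show ?thesis
          using cross2_eq_0D[of x z] nz(2) cz by (metis outer_scale_left)
      next
        case False
        then have "cross2 y z \<noteq> 0"
          using s by (simp add: y cross2_def mult.assoc flip: right_diff_distrib)
        then have "cross2 b c = 0" "cross2 a c = 0"
          using cross[OF M(1), of c z] cross[OF N, of c z] P cz False by auto
        then obtain t where t: "c = t *s a" and "t * cross2 b a = 0"
          using cross2_eq_0D[of a c] nz(1)
          by (force simp: cross2_def algebra_simps)
        moreover have "cross2 b a \<noteq> 0"
          using ab by (simp add: cross2_def algebra_simps)
        ultimately have "P = outer 0 x" using cz by simp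
        then show ?thesis ..
      qed
    qed
    with nz(2) show ?thesis by blast
  qed
qed

section \<open>The order of the two subgroups\<close>

text \<open>
  Complete \<open>y\<close> to a basis \<open>y, z\<close>.  Then \<open>(1 + y \<sqdot> a, z \<sqdot> a)\<close> are affine coordinates for \<open>a\<close>, and
  the condition restricts only the first of them.
\<close>

lemma card_affine_preimage:
  fixes y :: "'a::{field,finite} ^ 2"
  assumes "y \<noteq> 0"
  shows "card {a. 1 + dot2 y a \<in> D} = card D * CARD('a)"
proof -
  obtain z :: "'a ^ 2" where z: "cross2 y z \<noteq> 0"
  proof (cases "y $ 1 = 0")
    case True
    with assms have "cross2 y (vector [1, 0]) \<noteq> 0"
      by (auto simp: cross2_def vec_eq_iff forall_2)
    then show ?thesis by (rule that)
  next
    case False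
    then have "cross2 y (vector [0, 1]) \<noteq> 0"
      by (auto simp: cross2_def)
    then show ?thesis by (rule that)
  qed
  let ?f = "\<lambda>a. (1 + dot2 y a, dot2 z a)"
  have inj: "inj ?f"
  proof (rule injI)
    fix a b assume "?f a = ?f b"
    then have "dot2 y (a - b) = 0" and zab: "dot2 z (a - b) = 0"
      by (simp_all add: dot2_def algebra_simps)
    then obtain c where c: "a - b = c *s vector [- y $ 2, y $ 1]"
      using dot2_eq_0D[OF _ assms] by blast
    have "dot2 z (a - b) = c * cross2 y z"
      unfolding c by (simp add: dot2_def cross2_def algebra_simps)
    with z zab c show "a = b" by simp
  qed
  have "card (range ?f) = card (UNIV :: ('a \<times> 'a) set)"
    using card_image[OF inj] by (simp add: power2_eq_square)
  then have surj: "range ?f = UNIV"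
    by (rule card_eq_UNIV_imp_eq_UNIV[OF finite_class.finite_UNIV])
  have "{a. 1 + dot2 y a \<in> D} = ?f -` (D \<times> UNIV)"
    by auto
  also have "card \<dots> = card (D \<times> (UNIV :: 'a set))"
    by (rule card_vimage_inj[OF inj]) (simp only: surj subset_UNIV)
  finally show ?thesis
    by (simp only: card_cartesian_product)
qed

lemma outer_cancel_right:
  assumes "outer a x = outer b x" "x \<noteq> 0"
  shows "a = b"
  using assms by (auto simp: outer_def vec_eq_iff forall_2)

lemma outer_cancel_left:
  assumes "outer a x = outer a y" "a \<noteq> 0"
  shows "x = y"
  using assms by (auto simp: outer_def vec_eq_iff forall_2)

text \<open>Two invertible matrices of equal determinant differ by a factor in \<open>SL\<^sub>2\<close>.\<close>

lemma mem_iff_det_mem: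
  fixes G :: "('a::field ^ 2 ^ 2) set"
  assumes G: "subgroup G GL2" and SL: "SL2 \<subseteq> G"
  shows "A \<in> G \<longleftrightarrow> det A \<in> det ` G"
proof
  assume "det A \<in> det ` G"
  then obtain B where B: "B \<in> G" "det A = det B" by blast
  then have "invertible B"
    using subgroup.subset[OF G] by (auto simp: GL2_def)
  then obtain C where C: "B ** C = mat 1" "C ** B = mat 1"
    by (auto simp: invertible_def)
  have "det (A ** C) = det (B ** C)"
    by (simp add: det_mul B)
  then have "A ** C \<in> G"
    using SL by (auto simp: C SL2_def)
  then have "(A ** C) ** B \<in> G"
    using subgroup.m_closed[OF G, of "A ** C" B] B by (simp add: GL2_def)
  then show "A \<in> G"
    by (simp add: C flip: matrix_mul_assoc)
qed blast

text \<open>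
  A matrix fixes \<open>v\<close> iff the rows of its difference from the identity are orthogonal to \<open>v\<close>, hence
  multiples of the single vector \<open>y\<close>.
\<close>

lemma vec_stabilizer_eq_outer:
  fixes G :: "('a::field ^ 2 ^ 2) set"
  assumes G: "subgroup G GL2" and SL: "SL2 \<subseteq> G" and v: "v \<noteq> 0"
  defines "y \<equiv> vector [- v $ 2, v $ 1]"
  shows "vec_stabilizer G v = (\<lambda>a. mat 1 + outer a y) ` {a. 1 + dot2 y a \<in> det ` G}"
proof -
  have dot: "dot2 a y = dot2 y a" for a
    by (simp add: dot2_def)
  have yv: "dot2 y v = 0"
    by (simp add: dot2_def y_def)
  have "\<exists>a. M = mat 1 + outer a y" if "M *v v = v" for M
  proof -
    have "(M - mat 1) *v v = 0"
      using that by (simp add: matrix_vector_mult_diff_rdistrib)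
    then have "dot2 v ((M - mat 1) $ i) = 0" for i
      by (simp add: vec_eq_iff matrix_vector_mult_def dot2_def sum_2 mult.commute)
    then have "\<exists>c. (M - mat 1) $ i = c *s y" for i
      unfolding y_def by (rule dot2_eq_0D[OF _ v])
    then obtain c where "\<And>i. (M - mat 1) $ i = c i *s y" by metis
    then have "M - mat 1 = outer (\<chi> i. c i) y"
      by (simp add: vec_eq_iff outer_def)
    then show ?thesis
      by (metis add.commute diff_add_cancel)
  qed
  moreover have "(mat 1 + outer a y) *v v = v" for a
    by (simp add: matrix_vector_mult_add_rdistrib outer_mult_vec yv)
  moreover have "mat 1 + outer a y \<in> G \<longleftrightarrow> 1 + dot2 y a \<in> det ` G" for a
    by (subst mem_iff_det_mem[OF G SL]) (simp only: det_one_plus_outer dot)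
  ultimately show ?thesis
    unfolding vec_stabilizer_def by blast
qed

text \<open>
  This is the transposed picture: now the columns of the difference from the identity are
  multiples of the single vector \<open>w\<close>.
\<close>

lemma line_group_eq_outer:
  fixes G :: "('a::field ^ 2 ^ 2) set"
  assumes G: "subgroup G GL2" and SL: "SL2 \<subseteq> G"
  shows "line_group G w = (\<lambda>x. mat 1 + outer w x) ` {x. 1 + dot2 w x \<in> det ` G}"
proof -
  have "\<exists>x. M = mat 1 + outer w x" if "\<And>u. M *v u - u \<in> vec.span {w}" for M
  proof -
    have "\<exists>c. \<forall>i. (M - mat 1) $ i $ j = c * w $ i" for j
    proof -
      have "column j (M - mat 1) = M *v axis j 1 - axis j 1"
        by (simp add: matrix_vector_mult_def column_def axis_def mat_def vec_eq_iff if_distrib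
            cong: if_cong)
      then have "column j (M - mat 1) \<in> range (\<lambda>c. c *s w)"
        using that[of "axis j 1"] by (simp add: vec.span_singleton)
      then show ?thesis
        by (auto simp: column_def vec_eq_iff)
    qed
    then obtain c where "\<And>i j. (M - mat 1) $ i $ j = c j * w $ i" by metis
    then have "M - mat 1 = outer w (\<chi> j. c j)"
      by (simp add: vec_eq_iff outer_def mult.commute)
    then show ?thesis
      by (metis add.commute diff_add_cancel)
  qed
  moreover have "(mat 1 + outer w x) *v u - u \<in> vec.span {w}" for x u
    by (simp add: matrix_vector_mult_add_rdistrib outer_mult_vec vec.span_scale vec.span_base)
  moreover have "mat 1 + outer w x \<in> G \<longleftrightarrow> 1 + dot2 w x \<in> det ` G" for x
    by (subst mem_iff_det_mem[OF G SL]) (simp only: det_one_plus_outer)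
  ultimately show ?thesis
    unfolding line_group_def by blast
qed

lemma card_vec_stabilizer:
  fixes G :: "('a::{field,finite} ^ 2 ^ 2) set"
  assumes "subgroup G GL2" "SL2 \<subseteq> G" "v \<noteq> 0"
  shows "card (vec_stabilizer G v) = card (det ` G) * CARD('a)"
proof -
  have y: "vector [- v $ 2, v $ 1] \<noteq> (0 :: 'a ^ 2)"
    using assms(3) by (auto simp: vec_eq_iff forall_2)
  have "inj (\<lambda>a. mat 1 + outer a (vector [- v $ 2, v $ 1]))"
    by (rule injI) (use outer_cancel_right[OF _ y] in \<open>simp only: add_left_cancel\<close>)
  then show ?thesis
    by (simp only: vec_stabilizer_eq_outer[OF assms] card_image[OF inj_on_subset[OF _ subset_UNIV]]
        card_affine_preimage[OF y])
qed

lemma card_line_group: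
  fixes G :: "('a::{field,finite} ^ 2 ^ 2) set"
  assumes "subgroup G GL2" "SL2 \<subseteq> G" and w: "w \<noteq> 0"
  shows "card (line_group G w) = card (det ` G) * CARD('a)"
proof -
  have "inj (\<lambda>x. mat 1 + outer w x)"
    by (rule injI) (use outer_cancel_left[OF _ w] in \<open>simp only: add_left_cancel\<close>)
  then show ?thesis
    by (simp only: line_group_eq_outer[OF assms(1,2)] card_image[OF inj_on_subset[OF _ subset_UNIV]]
        card_affine_preimage[OF w])
qed

section \<open>Intersecting sets lie in cosets\<close>

lemma card_is_coset:
  assumes "group K" "finite (carrier K)" "H \<subseteq> carrier K" "is_coset K H X"
  shows "card X = card H"
  using assms(4) unfolding is_coset_def
proof
  assume "X \<in> lcosets\<^bsub>K\<^esub> H"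
  then show ?thesis using group.l_card_cosets_equal[OF assms(1) _ assms(3,2)] by metis
next
  assume "X \<in> rcosets\<^bsub>K\<^esub> H"
  then show ?thesis using group.card_rcosets_equal[OF assms(1) _ assms(3)] by metis
qed

text \<open>
  A common row direction of the differences \<open>M - A\<close> yields the left coset \<open>A G\<^sub>v\<close>, because
  \<open>M v = A v\<close> says that \<open>A\<^sup>-\<^sup>1 M\<close> fixes \<open>v\<close>.  A common column direction \<open>w\<close> survives multiplication
  by \<open>A\<^sup>-\<^sup>1\<close> from the right, so it yields a right coset of the line group.
\<close>

lemma intersecting_subset_coset:
  fixes G F :: "('a::field ^ 2 ^ 2) set"
  assumes G: "subgroup G GL2" and FG: "F \<subseteq> G" and F: "intersecting F" "F \<noteq> {}"
  defines "K \<equiv> GL2\<lparr>carrier := G\<rparr>"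
  shows "(\<exists>v X. v \<noteq> 0 \<and> is_coset K (vec_stabilizer G v) X \<and> F \<subseteq> X) \<or>
         (\<exists>w X. w \<noteq> 0 \<and> is_coset K (line_group G w) X \<and> F \<subseteq> X)"
proof -
  have mult: "M ** N \<in> G" if "M \<in> G" "N \<in> G" for M N
    using subgroup.m_closed[OF G that] by (simp add: GL2_def)
  obtain A where A: "A \<in> F" using F(2) by blast
  with FG have AG: "A \<in> G" by blast
  obtain B where B: "B \<in> G" "A ** B = mat 1" "B ** A = mat 1"
  proof
    interpret GL: group "GL2 :: ('a ^ 2 ^ 2) monoid" by (rule group_GL2)
    have "A \<in> carrier GL2" using AG subgroup.subset[OF G] by blast
    then show "A ** inv\<^bsub>GL2\<^esub> A = mat 1" "inv\<^bsub>GL2\<^esub> A ** A = mat 1"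
      using GL.r_inv[of A] GL.l_inv[of A] by (simp_all add: GL2_def)
    show "inv\<^bsub>GL2\<^esub> A \<in> G" by (rule subgroup.m_inv_closed[OF G AG])
  qed
  have sing: "det (M - N) = 0" if "M \<in> F" "N \<in> F" for M N
    using F(1) that unfolding intersecting_def det_eq_0_iff_kernel
    by (auto simp: matrix_vector_mult_diff_rdistrib)
  have "0 \<in> (\<lambda>M. M - A) ` F" using A by force
  moreover have "det (M - N) = 0" if "M \<in> (\<lambda>M. M - A) ` F" "N \<in> (\<lambda>M. M - A) ` F" for M N
    using that sing by auto
  ultimately consider
      w where "w \<noteq> 0" "\<And>M. M \<in> F \<Longrightarrow> \<exists>x. M - A = outer w x"
    | x where "x \<noteq> 0" "\<And>M. M \<in> F \<Longrightarrow> \<exists>a. M - A = outer a x"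
    using pairwise_singular_cases[of "(\<lambda>M. M - A) ` F"] by blast
  then show ?thesis
  proof cases
    case (1 w)
    have "M \<in> line_group G w #>\<^bsub>K\<^esub> A" if M: "M \<in> F" for M
    proof -
      obtain x where "M - A = outer w x" using 1(2) M by blast
      then have "M = outer w x + A"
        by (metis diff_add_cancel)
      then have "M ** B = outer w (x v* B) + mat 1"
        by (simp add: outer_mult_matrix B matrix_add_rdistrib)
      then have "(M ** B) *v u - u \<in> vec.span {w}" for u
        by (simp add: matrix_vector_mult_add_rdistrib outer_mult_vec vec.span_scale vec.span_base)
      then have "M ** B \<in> line_group G w"
        using mult M FG B(1) by (auto simp: line_group_def)
      moreover have "M = (M ** B) ** A"
        by (simp add: B flip: matrix_mul_assoc)
      ultimately show ?thesis
        by (auto simp: r_coset_def K_def GL2_def)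
    qed
    moreover have "is_coset K (line_group G w) (line_group G w #>\<^bsub>K\<^esub> A)"
      using AG by (auto simp: is_coset_def RCOSETS_def K_def)
    ultimately show ?thesis using 1(1) by blast
  next
    case (2 x)
    let ?v = "vector [- x $ 2, x $ 1] :: 'a ^ 2"
    have v: "?v \<noteq> 0"
      using 2(1) by (auto simp: vec_eq_iff forall_2)
    have "M \<in> A <#\<^bsub>K\<^esub> vec_stabilizer G ?v" if M: "M \<in> F" for M
    proof -
      obtain a where a: "M - A = outer a x" using 2(2) M by blast
      have "(M - A) *v ?v = 0"
        unfolding a outer_mult_vec by (simp add: dot2_def)
      then have "(B ** M) *v ?v = (B ** A) *v ?v"
        by (simp add: matrix_vector_mult_diff_rdistrib flip: matrix_vector_mul_assoc)
      then have "B ** M \<in> vec_stabilizer G ?v"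
        using mult M FG B(1) by (auto simp: vec_stabilizer_def B)
      moreover have "M = A ** (B ** M)"
        by (simp add: B matrix_mul_assoc)
      ultimately show ?thesis
        by (auto simp: l_coset_def K_def GL2_def)
    qed
    moreover have "is_coset K (vec_stabilizer G ?v) (A <#\<^bsub>K\<^esub> vec_stabilizer G ?v)"
      using AG by (auto simp: is_coset_def LCOSETS_def K_def)
    ultimately show ?thesis using v by blast
  qed
qed

theorem theorem10:
  fixes G F :: "('a::{field,finite} ^ 2 ^ 2) set" and q d :: nat
  assumes "q = CARD('a)"
    and "subgroup G GL2"
    and "SL2 \<subset> G"
    and "d = card (det ` G)"
    and "F \<subseteq> G"
    and "intersecting F"
  shows "card F \<le> d * q \<and>
    (card F = d * q \<longleftrightarrow>
      (\<exists>v. v \<noteq> 0 \<and> is_coset (GL2\<lparr>carrier := G\<rparr>) (vec_stabilizer G v) F) \<or>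
      (\<exists>w. w \<noteq> 0 \<and> is_coset (GL2\<lparr>carrier := G\<rparr>) (line_group G w) F))"
proof -
  let ?K = "GL2\<lparr>carrier := G\<rparr>"
  let ?C = "\<lambda>X. (\<exists>v. v \<noteq> 0 \<and> is_coset ?K (vec_stabilizer G v) X) \<or>
                (\<exists>w. w \<noteq> 0 \<and> is_coset ?K (line_group G w) X)"
  have SL: "SL2 \<subseteq> G" using assms(3) by blast
  have K: "group ?K" by (rule subgroup.subgroup_is_group[OF assms(2) group_GL2])
  have card: "card X = d * q" if "?C X" for X
  proof -
    have coset: "card X = card H" if "is_coset ?K H X" "H \<subseteq> G" for H
      using card_is_coset[OF K _ _ that(1)] that(2) by simp
    have "vec_stabilizer G v \<subseteq> G" "line_group G v \<subseteq> G" for v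
      by (auto simp: vec_stabilizer_def line_group_def)
    then show ?thesis
      using that coset card_vec_stabilizer[OF assms(2) SL] card_line_group[OF assms(2) SL] assms(1,4)
      by metis
  qed
  have "mat 1 \<in> G" using SL by (auto simp: SL2_def)
  then have "d > 0" "q > 0"
    by (auto simp: assms(1,4) card_gt_0_iff)
  show ?thesis
  proof (cases "F = {}")
    case True
    then show ?thesis using card[of F] \<open>d > 0\<close> \<open>q > 0\<close> by auto
  next
    case False
    obtain X where X: "?C X" "F \<subseteq> X"
      using intersecting_subset_coset[OF assms(2,5,6) False] by blast
    then have "card F \<le> d * q"
      using card_mono[of X F] card[OF X(1)] by simp
    moreover have "?C F" if "card F = d * q"
      using card_subset_eq[of X F] card[OF X(1)] X that by simp
    ultimately show ?thesis using card[of F] by blast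
  qed
qed

end
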